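(* Let $k \ge 2$ be an integer. Then $Q_d(0^k1^k) \cong Q_d(0^{k+1}1^{k-1})$ for every integer $d$ with $1 \le d \le 3k-1$.
   Context: A binary string of length $n$ is an element of $\{0,1\}^n$; strings are written with the usual concatenation notation, so $0^a1^b$ denotes the string consisting of $a$ bits $0$ followed by $b$ bits $1$. The $d$-cube $Q_d$ ($d \ge 1$) is the graph whose vertices are the binary strings of length $d$, with two vertices adjacent if and only if the strings differ in exactly one position. For a binary string $f$, the generalized Fibonacci cube $Q_d(f)$ is the subgraph of $Q_d$ induced by the set of all strings of length $d$ that do not contain $f$ as a consecutive (contiguous) substring (if $|f| > d$, then $Q_d(f) = Q_d$). $G \cong H$ means that the graphs $G$ and $H$ are isomorphic. *)

theory Defs
  imports "HOL-Library.Sublist" "Graph_Theory.Digraph_Isomorphism"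
begin

text \<open>
  Binary strings are boolean lists, with \<^term>\<open>False\<close> for the bit 0 and \<^term>\<open>True\<close> for the
  bit 1. Following the convention of the AFP entry \<open>Graph_Theory\<close>, a simple undirected graph is a
  finite loop-free symmetric digraph without parallel arcs: an edge between \<open>u\<close> and \<open>v\<close> is
  represented by the two arcs \<open>(u, v)\<close> and \<open>(v, u)\<close>.
\<close>

definition hypercube :: "nat \<Rightarrow> (bool list, bool list \<times> bool list) pre_digraph" where
  "hypercube d = \<lparr>
     verts = {u. length u = d},
     arcs = {(u, v). length u = d \<and> length v = d \<and> (\<exists>!i. i < d \<and> u ! i \<noteq> v ! i)},
     tail = fst,
     head = snd \<rparr>"

definition fib_cube :: "nat \<Rightarrow> bool list \<Rightarrow> (bool list, bool list \<times> bool list) pre_digraph" where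
  "fib_cube d f = hypercube d \<restriction> {u \<in> verts (hypercube d). \<not> sublist f u}"

definition zeros_ones :: "nat \<Rightarrow> nat \<Rightarrow> bool list" where
  "zeros_ones a b = replicate a False @ replicate b True"

lemma finite_bool_lists: "finite {u :: bool list. length u = d}"
  using finite_lists_length_eq[of "UNIV :: bool set" d] by simp

lemma graph_hypercube: "graph (hypercube d)"
proof -
  have "finite (arcs (hypercube d))"
    by (rule finite_subset[of _ "{u. length u = d} \<times> {u. length u = d}"])
       (auto simp: hypercube_def finite_bool_lists)
  moreover have "symmetric (hypercube d)"
    by (auto simp: symmetric_conv hypercube_def)
  moreover have "fst e \<noteq> snd e" if "e \<in> arcs (hypercube d)" for e
    using that by (cases e) (auto simp: hypercube_def)
  moreover have "length (fst e) = d" "length (snd e) = d" if "e \<in> arcs (hypercube d)" for e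
    using that by (cases e, simp add: hypercube_def)+
  moreover have "verts (hypercube d) = {u. length u = d}"
    and "tail (hypercube d) = fst" "head (hypercube d) = snd"
    by (simp_all add: hypercube_def)
  ultimately show ?thesis
    by unfold_locales (simp_all add: finite_bool_lists arc_to_ends_def)
qed

lemma verts_fib_cube: "verts (fib_cube d f) = {u. length u = d \<and> \<not> sublist f u}"
  by (auto simp: fib_cube_def hypercube_def)

lemma graph_fib_cube: "graph (fib_cube d f)"
proof -
  interpret graph "hypercube d" by (rule graph_hypercube)
  have ind: "induced_subgraph (fib_cube d f) (hypercube d)"
    unfolding fib_cube_def by (rule induced_induce) blast
  show ?thesis
    by (rule digraph.graphI[OF digraphI_induced[OF ind] induced_graph_imp_symmetric[OF sym_arcs ind]])
qed

lemma fib_cube_long: "d < length f \<Longrightarrow> fib_cube d f = hypercube d"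
  by (auto simp: fib_cube_def hypercube_def induce_subgraph_def dest: sublist_length_le)

text \<open>
  On these graphs, the digraph isomorphism of \<open>Graph_Theory\<close> is the usual notion: an adjacency
  preserving and reflecting bijection between the vertex sets.
\<close>

lemma digraph_iso_fib_cube_iff:
  "digraph_iso (fib_cube d f) (fib_cube d g) \<longleftrightarrow>
     (\<exists>\<phi>. bij_betw \<phi> (verts (fib_cube d f)) (verts (fib_cube d g)) \<and>
        (\<forall>u \<in> verts (fib_cube d f). \<forall>v \<in> verts (fib_cube d f).
           (u, v) \<in> arcs (fib_cube d f) \<longleftrightarrow> (\<phi> u, \<phi> v) \<in> arcs (fib_cube d g)))"
  (is "?L \<longleftrightarrow> ?R")
proof -
  let ?G = "fib_cube d f" and ?H = "fib_cube d g"
  have th: "tail (fib_cube d h) = fst" "head (fib_cube d h) = snd" for h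
    by (auto simp: fib_cube_def hypercube_def)
  have av: "u \<in> verts (fib_cube d h) \<and> v \<in> verts (fib_cube d h)"
    if "(u, v) \<in> arcs (fib_cube d h)" for u v h
    using that by (auto simp: fib_cube_def hypercube_def)
  show ?thesis
  proof
    assume ?L
    then obtain p where p: "pre_digraph.digraph_isomorphism ?G p" and H: "?H = app_iso p ?G"
      unfolding digraph_iso_def by blast
    let ?\<phi> = "iso_verts p"
    have inj: "inj_on ?\<phi> (verts ?G)"
      using p by (simp add: pre_digraph.digraph_isomorphism_def)
    have ends: "iso_tail p = fst" "iso_head p = snd"
      using th[of g] H by (metis tail_app_iso, metis head_app_iso)
    have arc: "iso_arcs p a = (?\<phi> (fst a), ?\<phi> (snd a))" if "a \<in> arcs ?G" for a
      using p that by (auto simp: pre_digraph.digraph_isomorphism_def th ends prod_eq_iff)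
    have "bij_betw ?\<phi> (verts ?G) (verts ?H)"
      using inj H by (metis bij_betw_def verts_app_iso)
    moreover have "(u, v) \<in> arcs ?G \<longleftrightarrow> (?\<phi> u, ?\<phi> v) \<in> arcs ?H"
      if uv: "u \<in> verts ?G" "v \<in> verts ?G" for u v
    proof -
      have "arcs ?H = iso_arcs p ` arcs ?G" using H by (metis arcs_app_iso)
      also have "\<dots> = (\<lambda>a. (?\<phi> (fst a), ?\<phi> (snd a))) ` arcs ?G"
        by (rule image_cong) (simp_all add: arc)
      finally have "arcs ?H = (\<lambda>a. (?\<phi> (fst a), ?\<phi> (snd a))) ` arcs ?G" .
      then have "(?\<phi> u, ?\<phi> v) \<in> arcs ?H \<longleftrightarrow>
        (\<exists>x y. (x, y) \<in> arcs ?G \<and> ?\<phi> u = ?\<phi> x \<and> ?\<phi> v = ?\<phi> y)"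
        by (auto simp: image_iff Bex_def)
      also have "\<dots> \<longleftrightarrow> (u, v) \<in> arcs ?G"
        using uv av inj_onD[OF inj] by metis
      finally show ?thesis by simp
    qed
    ultimately show ?R by blast
  next
    assume ?R
    then obtain \<phi> where bij: "bij_betw \<phi> (verts ?G) (verts ?H)"
      and adj: "\<And>u v. u \<in> verts ?G \<Longrightarrow> v \<in> verts ?G \<Longrightarrow>
        (u, v) \<in> arcs ?G \<longleftrightarrow> (\<phi> u, \<phi> v) \<in> arcs ?H" by blast
    let ?p = "\<lparr>iso_verts = \<phi>, iso_arcs = map_prod \<phi> \<phi>, iso_head = snd, iso_tail = fst\<rparr>"
    interpret G: graph ?G by (rule graph_fib_cube)
    have inj: "inj_on \<phi> (verts ?G)" and im: "\<phi> ` verts ?G = verts ?H"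
      using bij by (auto simp: bij_betw_def)
    have "inj_on (map_prod \<phi> \<phi>) (verts ?G \<times> verts ?G)"
      using map_prod_inj_on[OF inj inj] .
    then have "inj_on (map_prod \<phi> \<phi>) (arcs ?G)"
      by (rule inj_on_subset) (auto dest: av)
    then have "pre_digraph.digraph_isomorphism ?G ?p"
      using inj G.wf_digraph by (simp add: pre_digraph.digraph_isomorphism_def th)
    moreover have "arcs ?H = map_prod \<phi> \<phi> ` arcs ?G"
    proof (intro equalityI subsetI)
      fix a assume a: "a \<in> arcs ?H"
      obtain x y where xy: "a = (x, y)" by fastforce
      with a av[of x y g] im obtain u v
        where "u \<in> verts ?G" "v \<in> verts ?G" "x = \<phi> u" "y = \<phi> v" by blast
      with a xy adj show "a \<in> map_prod \<phi> \<phi> ` arcs ?G" by force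
    next
      fix a assume "a \<in> map_prod \<phi> \<phi> ` arcs ?G"
      then obtain u v where "(u, v) \<in> arcs ?G" "a = (\<phi> u, \<phi> v)" by auto
      with av[of u v f] adj[of u v] show "a \<in> arcs ?H" by blast
    qed
    then have "?H = app_iso ?p ?G"
      using th[of g] by (simp add: app_iso_def im)
    ultimately show ?L unfolding digraph_iso_def by blast
  qed
qed

end

theory Submission
  imports Defs
begin

text \<open>
  For \<open>d < 2k\<close> both graphs are the whole cube. Otherwise write \<open>d = 2k + m\<close>, where \<open>m < k\<close>. The
  isomorphism is then the restriction of a symmetry of the whole cube: permute the coordinates and
  complement one of them.

  The strings that contain \<open>f\<close> at position \<open>i\<close> form a subcube, for each \<open>i \<le> m\<close>, and it suffices
  to map the \<open>i\<close>-th subcube of \<open>0\<^sup>k1\<^sup>k\<close> onto the \<open>i\<close>-th subcube of \<open>0\<^sup>k\<^sup>+\<^sup>11\<^sup>k\<^sup>-\<^sup>1\<close>. Because \<open>m < k\<close>,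
  every occurrence covers the window of coordinates \<open>k, \<dots>, k + m\<close>, no matter where it begins. In
  this window an occurrence of \<open>0\<^sup>k1\<^sup>k\<close> at \<open>i\<close> reads \<open>0\<^sup>i1\<^sup>m\<^sup>-\<^sup>i1\<close>, and one of \<open>0\<^sup>k\<^sup>+\<^sup>11\<^sup>k\<^sup>-\<^sup>1\<close> reads
  \<open>00\<^sup>i1\<^sup>m\<^sup>-\<^sup>i\<close>. To the left of the window both demand 0 and to the right of it both demand 1, at the
  same coordinates. So the map that removes the last bit of the window, complements it and puts it
  in front of the window does what is needed, for all \<open>i\<close> at once.
\<close>

definition signed_perm :: "nat \<Rightarrow> (nat \<Rightarrow> nat) \<Rightarrow> (nat \<Rightarrow> bool) \<Rightarrow> bool list \<Rightarrow> bool list" where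
  "signed_perm d \<sigma> s u = map (\<lambda>c. u ! \<sigma> c \<noteq> s c) [0..<d]"

lemma length_signed_perm [simp]: "length (signed_perm d \<sigma> s u) = d"
  by (simp add: signed_perm_def)

lemma nth_signed_perm [simp]: "c < d \<Longrightarrow> signed_perm d \<sigma> s u ! c \<longleftrightarrow> u ! \<sigma> c \<noteq> s c"
  by (simp add: signed_perm_def)

lemma bij_betw_signed_perm:
  assumes "bij_betw \<sigma> {..<d} {..<d}"
  shows "bij_betw (signed_perm d \<sigma> s) {u. length u = d} {u. length u = d}"
proof -
  have "inj_on (signed_perm d \<sigma> s) {u. length u = d}"
  proof (rule inj_onI)
    fix u v
    assume len: "u \<in> {u. length u = d}" "v \<in> {u. length u = d}"
      and eq: "signed_perm d \<sigma> s u = signed_perm d \<sigma> s v"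
    have "u ! i = v ! i" if "i < d" for i
    proof -
      have "i \<in> \<sigma> ` {..<d}"
        using that by (simp add: bij_betw_imp_surj_on[OF assms])
      then obtain c where "c < d" "i = \<sigma> c" by blast
      with arg_cong[OF eq, of "\<lambda>w. w ! c"] show ?thesis by auto
    qed
    with len show "u = v" by (simp add: nth_equalityI)
  qed
  moreover have "signed_perm d \<sigma> s ` {u. length u = d} \<subseteq> {u. length u = d}"
    by auto
  ultimately show ?thesis
    by (simp add: bij_betw_def endo_inj_surj finite_bool_lists)
qed

lemma signed_perm_adjacent_iff:
  assumes "bij_betw \<sigma> {..<d} {..<d}"
  shows "(\<exists>!i. i < d \<and> signed_perm d \<sigma> s u ! i \<noteq> signed_perm d \<sigma> s v ! i)
    \<longleftrightarrow> (\<exists>!i. i < d \<and> u ! i \<noteq> v ! i)"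
proof -
  have "(\<exists>!i. i < d \<and> u ! i \<noteq> v ! i) \<longleftrightarrow> (\<exists>!c. c < d \<and> u ! \<sigma> c \<noteq> v ! \<sigma> c)"
    using bij_betw_imp_inj_on[OF assms] bij_betw_imp_surj_on[OF assms]
    unfolding inj_on_def image_def by (smt (verit) lessThan_iff mem_Collect_eq)
  also have "\<dots> \<longleftrightarrow> (\<exists>!i. i < d \<and> signed_perm d \<sigma> s u ! i \<noteq> signed_perm d \<sigma> s v ! i)"
    by (rule arg_cong[where f = Ex1]) auto
  finally show ?thesis by simp
qed

lemma arcs_fib_cube:
  "(u, v) \<in> arcs (fib_cube d f) \<longleftrightarrow>
    u \<in> verts (fib_cube d f) \<and> v \<in> verts (fib_cube d f) \<and> (\<exists>!i. i < d \<and> u ! i \<noteq> v ! i)"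
  by (auto simp: fib_cube_def hypercube_def)

text \<open>
  A signed coordinate permutation is a symmetry of the whole cube and the graphs are induced
  subgraphs of it, so only the correspondence between the forbidden vertices has to be checked.
\<close>

lemma digraph_iso_fib_cube_signed_perm:
  assumes \<sigma>: "bij_betw \<sigma> {..<d} {..<d}"
    and sub: "\<And>u. length u = d \<Longrightarrow> sublist f u \<longleftrightarrow> sublist g (signed_perm d \<sigma> s u)"
  shows "digraph_iso (fib_cube d f) (fib_cube d g)"
proof -
  let ?\<phi> = "signed_perm d \<sigma> s"
  have mem: "?\<phi> u \<in> verts (fib_cube d g) \<longleftrightarrow> u \<in> verts (fib_cube d f)" if "length u = d" for u
    using that sub by (simp add: verts_fib_cube)
  have "bij_betw ?\<phi> (verts (fib_cube d f)) (verts (fib_cube d g))"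
  proof (rule bij_betw_subset[OF bij_betw_signed_perm[OF \<sigma>]])
    show "verts (fib_cube d f) \<subseteq> {u. length u = d}"
      by (auto simp: verts_fib_cube)
    have surj: "?\<phi> ` {u. length u = d} = {u. length u = d}"
      using bij_betw_signed_perm[OF \<sigma>] by (rule bij_betw_imp_surj_on)
    show "?\<phi> ` verts (fib_cube d f) = verts (fib_cube d g)"
    proof (intro equalityI subsetI)
      fix w assume w: "w \<in> verts (fib_cube d g)"
      then have "w \<in> ?\<phi> ` {u. length u = d}"
        unfolding surj by (simp add: verts_fib_cube)
      then obtain u where "length u = d" "w = ?\<phi> u" by blast
      with w mem show "w \<in> ?\<phi> ` verts (fib_cube d f)" by blast
    next
      fix w assume "w \<in> ?\<phi> ` verts (fib_cube d f)"
      then obtain u where "u \<in> verts (fib_cube d f)" "w = ?\<phi> u" by blast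
      with mem[of u] show "w \<in> verts (fib_cube d g)" by (simp add: verts_fib_cube)
    qed
  qed
  moreover have "(u, v) \<in> arcs (fib_cube d f) \<longleftrightarrow> (?\<phi> u, ?\<phi> v) \<in> arcs (fib_cube d g)"
    if "u \<in> verts (fib_cube d f)" "v \<in> verts (fib_cube d f)" for u v
    using that mem
    unfolding arcs_fib_cube signed_perm_adjacent_iff[OF \<sigma>] by (auto simp: verts_fib_cube)
  ultimately show ?thesis
    unfolding digraph_iso_fib_cube_iff by blast
qed

text \<open>
  An occurrence is described by the absolute coordinates \<open>c\<close> of the ambient string, so that two
  words of the same length can be compared coordinate by coordinate.
\<close>

lemma sublist_iff_nth:
  "sublist f u \<longleftrightarrow>
    (\<exists>i. i + length f \<le> length u \<and> (\<forall>c. i \<le> c \<and> c < i + length f \<longrightarrow> u ! c = f ! (c - i)))"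
  (is "_ \<longleftrightarrow> ?R")
proof
  assume "sublist f u"
  then obtain p q where "u = p @ f @ q" by (auto simp: sublist_def)
  then show ?R
    by (intro exI[of _ "length p"]) (auto simp: nth_append)
next
  assume ?R
  then obtain i where len: "i + length f \<le> length u"
    and eq: "\<And>c. i \<le> c \<Longrightarrow> c < i + length f \<Longrightarrow> u ! c = f ! (c - i)" by blast
  have "take (length f) (drop i u) = f"
    using len eq by (intro nth_equalityI) auto
  then have "u = take i u @ f @ drop (length f) (drop i u)"
    by (metis append_take_drop_id)
  then show "sublist f u" by (auto simp: sublist_def)
qed

lemma sublist_zeros_ones_iff:
  assumes "length u = a + b + m"
  shows "sublist (zeros_ones a b) u \<longleftrightarrow>
    (\<exists>i\<le>m. \<forall>c. i \<le> c \<and> c < i + a + b \<longrightarrow> (u ! c \<longleftrightarrow> i + a \<le> c))"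
proof -
  have "zeros_ones a b ! (c - i) \<longleftrightarrow> i + a \<le> c" if "i \<le> c" "c < i + a + b" for c i
    using that by (auto simp: zeros_ones_def nth_append)
  then have "(\<forall>c. i \<le> c \<and> c < i + (a + b) \<longrightarrow> u ! c = zeros_ones a b ! (c - i)) \<longleftrightarrow>
      (\<forall>c. i \<le> c \<and> c < i + a + b \<longrightarrow> (u ! c \<longleftrightarrow> i + a \<le> c))" for i
    by (auto simp: add.assoc)
  moreover have "length (zeros_ones a b) = a + b"
    by (simp add: zeros_ones_def)
  ultimately show ?thesis
    using assms unfolding sublist_iff_nth by auto
qed

text \<open>
  The value at \<open>c\<close> is the coordinate from which bit \<open>c\<close> of the image is read, so the bits of the
  window move one place to the right and the last one returns to the front.
\<close>

definition window_rot :: "nat \<Rightarrow> nat \<Rightarrow> nat \<Rightarrow> nat" where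
  "window_rot k m c = (if c = k then k + m else if k < c \<and> c \<le> k + m then c - 1 else c)"

lemma bij_betw_window_rot:
  assumes "k + m < d"
  shows "bij_betw (window_rot k m) {..<d} {..<d}"
proof -
  have "inj_on (window_rot k m) {..<d}"
    by (rule inj_onI) (auto simp: window_rot_def split: if_splits)
  moreover have "window_rot k m ` {..<d} \<subseteq> {..<d}"
    using assms by (auto simp: window_rot_def)
  ultimately show ?thesis
    by (simp add: bij_betw_def endo_inj_surj)
qed

text \<open>
  The two systems of constraints for an occurrence at \<open>i\<close> are matched by the rotation: \<open>c\<close> lies in
  the range of the occurrence iff \<open>window_rot k m c\<close> does, since \<open>i \<le> m < k\<close> puts the window inside
  this range. The demands agree as well, up to the complementation at \<open>k\<close>: there the demand of
  \<open>0\<^sup>k1\<^sup>k\<close> on coordinate \<open>k + m\<close> is 1, whereas that of \<open>0\<^sup>k\<^sup>+\<^sup>11\<^sup>k\<^sup>-\<^sup>1\<close> on coordinate \<open>k\<close> is 0.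
\<close>

lemma occurrence_window_rot_iff:
  fixes u :: "bool list"
  assumes "m < k" "i \<le> m" "d = 2 * k + m"
  shows "(\<forall>c. i \<le> c \<and> c < i + 2 * k \<longrightarrow> (u ! c \<longleftrightarrow> i + k \<le> c)) \<longleftrightarrow>
    (\<forall>c. i \<le> c \<and> c < i + 2 * k \<longrightarrow>
      (signed_perm d (window_rot k m) (\<lambda>c. c = k) u ! c \<longleftrightarrow> i + (k + 1) \<le> c))"
  (is "?L \<longleftrightarrow> ?R")
proof -
  have range: "i \<le> window_rot k m c \<and> window_rot k m c < i + 2 * k \<longleftrightarrow> i \<le> c \<and> c < i + 2 * k" for c
    using assms by (auto simp: window_rot_def)
  have demand: "(i + k \<le> window_rot k m c) \<noteq> (c = k) \<longleftrightarrow> i + (k + 1) \<le> c" for c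
    using assms by (auto simp: window_rot_def)
  have bij: "bij_betw (window_rot k m) {..<d} {..<d}"
    using assms by (intro bij_betw_window_rot) simp
  have in_d: "c < d" if "c < i + 2 * k" for c
    using that assms by simp
  have "?L \<longleftrightarrow> (\<forall>c\<in>{..<d}. i \<le> c \<and> c < i + 2 * k \<longrightarrow> (u ! c \<longleftrightarrow> i + k \<le> c))"
    using in_d by auto
  also have "\<dots> \<longleftrightarrow> (\<forall>c\<in>{..<d}. i \<le> window_rot k m c \<and> window_rot k m c < i + 2 * k \<longrightarrow>
      (u ! window_rot k m c \<longleftrightarrow> i + k \<le> window_rot k m c))"
    by (subst bij_betw_imp_surj_on[OF bij, symmetric]) (simp only: ball_simps)
  also have "\<dots> \<longleftrightarrow> (\<forall>c\<in>{..<d}. i \<le> c \<and> c < i + 2 * k \<longrightarrow>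
      (signed_perm d (window_rot k m) (\<lambda>c. c = k) u ! c \<longleftrightarrow> i + (k + 1) \<le> c))"
    unfolding range using demand by auto
  also have "\<dots> \<longleftrightarrow> ?R"
    using in_d by auto
  finally show ?thesis .
qed

theorem theorem2p2:
  fixes k d :: nat
  assumes "k \<ge> 2" and "1 \<le> d" and "d \<le> 3 * k - 1"
  shows "digraph_iso (fib_cube d (zeros_ones k k)) (fib_cube d (zeros_ones (k + 1) (k - 1)))"
proof (cases "d < 2 * k")
  case True
  then have "\<not> sublist (zeros_ones a b) u" if "length u = d" "a + b = 2 * k" for a b u
    using that by (auto simp: zeros_ones_def dest!: sublist_length_le)
  then show ?thesis
    using assms by (intro digraph_iso_fib_cube_signed_perm[of id]) (auto simp: bij_betw_id)
next
  case False
  define m where "m = d - 2 * k"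
  have m: "m < k" "d = 2 * k + m"
    using False assms by (auto simp: m_def)
  show ?thesis
  proof (rule digraph_iso_fib_cube_signed_perm)
    show "bij_betw (window_rot k m) {..<d} {..<d}"
      using m by (intro bij_betw_window_rot) simp
    fix u :: "bool list"
    assume u: "length u = d"
    let ?w = "signed_perm d (window_rot k m) (\<lambda>c. c = k) u"
    have sum: "i + k + k = i + 2 * k" "i + (k + 1) + (k - 1) = i + 2 * k" for i
      using m by auto
    have "sublist (zeros_ones k k) u \<longleftrightarrow>
        (\<exists>i\<le>m. \<forall>c. i \<le> c \<and> c < i + 2 * k \<longrightarrow> (u ! c \<longleftrightarrow> i + k \<le> c))"
      using u m sublist_zeros_ones_iff[of u k k m, unfolded sum] by simp
    also have "\<dots> \<longleftrightarrow> (\<exists>i\<le>m. \<forall>c. i \<le> c \<and> c < i + 2 * k \<longrightarrow> (?w ! c \<longleftrightarrow> i + (k + 1) \<le> c))"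
      using occurrence_window_rot_iff[OF m(1) _ m(2)] by blast
    also have "\<dots> \<longleftrightarrow> sublist (zeros_ones (k + 1) (k - 1)) ?w"
      using m sublist_zeros_ones_iff[of ?w "k + 1" "k - 1" m, unfolded sum] by simp
    finally show "sublist (zeros_ones k k) u \<longleftrightarrow> sublist (zeros_ones (k + 1) (k - 1)) ?w" .
  qed
qed

end
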